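(* The convex topology on a median algebra $M$ is quasi compact if and only if the poc set $M^\circ$ is of type $\omega$.
   Context: A median algebra is a nonempty set $M$ with a map $m: M^3\to M$ such that: $m(x,y,z)=m(x,z,y)=m(y,z,x)$; $m(x,x,y)=x$; $m(m(x,y,z),u,v)=m(x,m(y,u,v),m(z,u,v))$. A subset $C\subseteq M$ is convex if $m(x,y,z)\in C$ for all $x,y\in C$, $z\in M$. A half space is a subset $H\subseteq M$ such that $H$ and $H^*:=M\setminus H$ are both convex. The convex topology on $M$ is the topology having the set of all half spaces of $M$ as a subbasis of open sets. Quasi compact means every open cover has a finite subcover (no Hausdorff condition). $M^\circ$ is the set of all half spaces of $M$ (including $\varnothing$ and $M$), ordered by inclusion, with involution $H\mapsto H^*$ and least element $0=\varnothing$. Two elements $a,b$ of a poc set are nested if $a$ is comparable with $b$ or with $b^*$, and transverse otherwise. A subset is transverse if any two distinct elements of it are transverse. A poc set is of type $\omega$ if every chain in it is finite and every transverse subset of it is finite. *)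

theory Defs
  imports "HOL-Analysis.Analysis"
begin

locale median_algebra =
  fixes M :: "'a set" and m :: "'a \<Rightarrow> 'a \<Rightarrow> 'a \<Rightarrow> 'a"
  assumes nonempty: "M \<noteq> {}"
    and closed: "\<lbrakk>x \<in> M; y \<in> M; z \<in> M\<rbrakk> \<Longrightarrow> m x y z \<in> M"
    and swap: "\<lbrakk>x \<in> M; y \<in> M; z \<in> M\<rbrakk> \<Longrightarrow> m x y z = m x z y"
    and rotate: "\<lbrakk>x \<in> M; y \<in> M; z \<in> M\<rbrakk> \<Longrightarrow> m x y z = m y z x"
    and absorb: "\<lbrakk>x \<in> M; y \<in> M\<rbrakk> \<Longrightarrow> m x x y = x"
    and distrib: "\<lbrakk>x \<in> M; y \<in> M; z \<in> M; u \<in> M; v \<in> M\<rbrakk> \<Longrightarrow>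
      m (m x y z) u v = m x (m y u v) (m z u v)"

definition median_convex :: "'a set \<Rightarrow> ('a \<Rightarrow> 'a \<Rightarrow> 'a \<Rightarrow> 'a) \<Rightarrow> 'a set \<Rightarrow> bool" where
  "median_convex M m C \<longleftrightarrow> C \<subseteq> M \<and> (\<forall>x\<in>C. \<forall>y\<in>C. \<forall>z\<in>M. m x y z \<in> C)"

definition half_spaces :: "'a set \<Rightarrow> ('a \<Rightarrow> 'a \<Rightarrow> 'a \<Rightarrow> 'a) \<Rightarrow> 'a set set" where
  "half_spaces M m = {H. H \<subseteq> M \<and> median_convex M m H \<and> median_convex M m (M - H)}"

definition convex_topology :: "'a set \<Rightarrow> ('a \<Rightarrow> 'a \<Rightarrow> 'a \<Rightarrow> 'a) \<Rightarrow> 'a topology" where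
  "convex_topology M m = topology_generated_by (half_spaces M m)"

locale poc_set =
  fixes P :: "'b set" and le :: "'b \<Rightarrow> 'b \<Rightarrow> bool" and star :: "'b \<Rightarrow> 'b" and zero :: 'b
  assumes refl: "a \<in> P \<Longrightarrow> le a a"
    and antisym: "\<lbrakk>a \<in> P; b \<in> P; le a b; le b a\<rbrakk> \<Longrightarrow> a = b"
    and trans: "\<lbrakk>a \<in> P; b \<in> P; c \<in> P; le a b; le b c\<rbrakk> \<Longrightarrow> le a c"
    and zero_closed: "zero \<in> P"
    and zero_least: "a \<in> P \<Longrightarrow> le zero a"
    and star_closed: "a \<in> P \<Longrightarrow> star a \<in> P"
    and star_star: "a \<in> P \<Longrightarrow> star (star a) = a"
    and star_antimono: "\<lbrakk>a \<in> P; b \<in> P; le a b\<rbrakk> \<Longrightarrow> le (star b) (star a)"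
    and zero_neq_star: "zero \<noteq> star zero"
    and le_star: "\<lbrakk>a \<in> P; le a (star a)\<rbrakk> \<Longrightarrow> a = zero"

definition poc_nested :: "('b \<Rightarrow> 'b \<Rightarrow> bool) \<Rightarrow> ('b \<Rightarrow> 'b) \<Rightarrow> 'b \<Rightarrow> 'b \<Rightarrow> bool" where
  "poc_nested le star a b \<longleftrightarrow> le a b \<or> le b a \<or> le a (star b) \<or> le (star b) a"

definition poc_transverse :: "('b \<Rightarrow> 'b \<Rightarrow> bool) \<Rightarrow> ('b \<Rightarrow> 'b) \<Rightarrow> 'b \<Rightarrow> 'b \<Rightarrow> bool" where
  "poc_transverse le star a b \<longleftrightarrow> \<not> poc_nested le star a b"

definition poc_type_omega :: "'b set \<Rightarrow> ('b \<Rightarrow> 'b \<Rightarrow> bool) \<Rightarrow> ('b \<Rightarrow> 'b) \<Rightarrow> bool" where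
  "poc_type_omega P le star \<longleftrightarrow>
     (\<forall>C\<subseteq>P. Complete_Partial_Order.chain le C \<longrightarrow> finite C) \<and>
     (\<forall>T\<subseteq>P. pairwise (poc_transverse le star) T \<longrightarrow> finite T)"

lemma (in median_algebra) poc_set_half_spaces:
  "poc_set (half_spaces M m) (\<subseteq>) (\<lambda>H. M - H) {}"
proof
  fix H
  assume "H \<in> half_spaces M m" 
  then have H: "H \<subseteq> M" by (simp add: half_spaces_def)
  then show "M - (M - H) = H" by blast
  show "H = {}" if "H \<subseteq> M - H" using H that by blast
qed (use nonempty closed in \<open>auto simp: half_spaces_def median_convex_def double_diff\<close>)

lemma (in median_algebra) topspace_convex_topology: "topspace (convex_topology M m) = M"
proof -
  have "M \<in> half_spaces M m"
    using closed by (auto simp: half_spaces_def median_convex_def)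
  moreover have "H \<subseteq> M" if "H \<in> half_spaces M m" for H
    using that by (simp add: half_spaces_def)
  ultimately show ?thesis
    unfolding convex_topology_def topology_generated_by_topspace by blast
qed

end

theory Submission imports Defs begin

text \<open>
  A half space is open by definition, and so is its complement; hence half spaces are clopen, and
  compact as soon as the space is.

  Suppose the space is compact. The union of a chain of half spaces is again a half space, because
  its complement is an intersection of convex sets. Compactness then says that the union is a member
  of the chain, and dually for the intersection. A chain all of whose nonempty subfamilies have
  a largest and a least member is finite. For transverse families, suppose that \<open>T\<close> is an infinite
  one. Any choice of sides gives pairwise intersecting convex sets, so Helly's theorem (\<open>helly\<close>) and
  compactness yield a point realising it. The points lying in only finitely many members of \<open>T\<close>
  form a convex set \<open>B\<close> disjoint from the convex set \<open>\<Inter>T\<close>, and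
  Kakutani's separation theorem (\<open>convex_separation\<close>) gives a half space \<open>H\<close> containing \<open>\<Inter>T\<close>
  and missing \<open>B\<close>. By compactness of the complement of \<open>H\<close>, already \<open>\<Inter>F \<subseteq> H\<close> for some finite
  \<open>F \<subseteq> T\<close>. But the point lying in exactly the members of \<open>F\<close> belongs to \<open>B\<close>, a contradiction.

  Conversely, suppose the half spaces are of type omega. By Alexander's subbase theorem it
  suffices to treat covers by half spaces. Suppose that such a cover has no finite subcover. Since
  chains are finite, its maximal members still cover. Two distinct maximal members with a common
  point are transverse: they are incomparable, and together they do not cover. So every
  point lies in only finitely many maximal members. Hence there are points \<open>x\<close>, \<open>y\<close>, \<open>z\<close> such that
  no maximal member contains two of them: \<open>y\<close> avoids the finitely many maximal members at \<open>x\<close>, and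
  \<open>z\<close> avoids those at \<open>x\<close> and those at \<open>y\<close>. Every maximal member has two of the three points in its
  convex complement, so its complement contains \<open>m x y z\<close>, which is therefore not covered.
\<close>

section \<open>Chains of sets\<close>

text \<open>The hypotheses, applied to pairs, make the family a chain. The members with only finitely many
  members below them include the least member and are closed under passing to the successor, which
  exists as the least strictly larger member. The largest of them can therefore have no successor,
  so it bounds the whole chain.\<close>

lemma finite_if_max_min:
  assumes max: "\<And>\<D>. \<lbrakk>\<D> \<subseteq> \<C>; \<D> \<noteq> {}\<rbrakk> \<Longrightarrow> \<Union>\<D> \<in> \<D>"
    and min: "\<And>\<D>. \<lbrakk>\<D> \<subseteq> \<C>; \<D> \<noteq> {}\<rbrakk> \<Longrightarrow> \<Inter>\<D> \<in> \<D>"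
  shows "finite \<C>"
proof (cases "\<C> = {}")
  case False
  define below where "below S = {D \<in> \<C>. D \<subseteq> S}" for S
  define \<S> where "\<S> = {S \<in> \<C>. finite (below S)}"
  have "below (\<Inter>\<C>) = {\<Inter>\<C>}" using min[of \<C>] False by (auto simp: below_def)
  then have "\<Inter>\<C> \<in> \<S>" using min[of \<C>] False by (simp add: \<S>_def)
  then have S: "\<Union>\<S> \<in> \<S>" by (intro max) (auto simp: \<S>_def)
  show ?thesis
  proof (cases "below (\<Union>\<S>) = \<C>")
    case True
    then show ?thesis using S by (simp add: \<S>_def)
  next
    case False
    let ?R = "\<C> - below (\<Union>\<S>)"
    have T: "\<Inter>?R \<in> ?R" using False by (intro min) (auto simp: below_def)
    have "below (\<Inter>?R) \<subseteq> insert (\<Inter>?R) (below (\<Union>\<S>))" unfolding below_def by blast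
    then have "finite (below (\<Inter>?R))" using S by (simp add: \<S>_def finite_subset)
    then have "\<Inter>?R \<in> \<S>" using T by (simp add: \<S>_def)
    then show ?thesis using T by (auto simp: below_def)
  qed
qed simp

section \<open>Median arithmetic and convex sets\<close>

context median_algebra
begin

lemma swap12: "\<lbrakk>x \<in> M; y \<in> M; z \<in> M\<rbrakk> \<Longrightarrow> m x y z = m y x z"
  using rotate[of x y z] swap[of y z x] by simp

text \<open>As ordered rewrite rules, these two transpositions sort the arguments of every median, so
  that the simplifier decides equality up to permutation.\<close>

lemmas median_perm = swap12 swap

lemma absorb2: "\<lbrakk>x \<in> M; y \<in> M\<rbrakk> \<Longrightarrow> m x y x = x" "\<lbrakk>x \<in> M; y \<in> M\<rbrakk> \<Longrightarrow> m y x x = x"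
  using absorb[of x y] swap[of x y x] rotate[of y x x] by simp_all

text \<open>The distributive law with the undistributed argument last and the outer pair first. All
  computations with medians below are instances of it.\<close>

lemma distrib3:
  assumes "x \<in> M" "y \<in> M" "z \<in> M" "u \<in> M" "v \<in> M"
  shows "m u v (m x y z) = m (m u v x) (m u v y) z"
proof -
  have "m u v (m x y z) = m (m z x y) u v"
    using assms by (simp add: closed median_perm)
  also have "\<dots> = m z (m x u v) (m y u v)"
    using assms by (simp add: distrib)
  also have "\<dots> = m (m u v x) (m u v y) z"
    using assms by (simp add: closed median_perm)
  finally show ?thesis .
qed

text \<open>The equation \<open>m p y x = x\<close> says that \<open>x\<close> lies between \<open>p\<close> and \<open>y\<close>. For fixed \<open>p\<close> this
  is a partial order with least element \<open>p\<close>; here \<open>x \<le> y \<le> w\<close>.\<close>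

lemma between_trans:
  assumes "p \<in> M" "x \<in> M" "y \<in> M" "w \<in> M"
    and "m p y x = x" "m p w y = y"
  shows "m p w x = x"
proof -
  have "m p w x = m p w (m p y x)" using assms by simp
  also have "\<dots> = m (m p w p) (m p w y) x" using assms by (intro distrib3)
  also have "\<dots> = x" using assms by (simp add: absorb2)
  finally show ?thesis .
qed

text \<open>The median is monotone in its first argument for the order based at \<open>p\<close>: writing \<open>x\<close> as
  \<open>m h x p\<close> and distributing exhibits \<open>m x y z\<close> as a point between \<open>p\<close> and \<open>m h y z\<close>.\<close>

lemma between_mono:
  assumes "p \<in> M" "h \<in> M" "x \<in> M" "y \<in> M" "z \<in> M" and x: "m p h x = x"
  shows "m p (m h y z) (m x y z) = m x y z"
proof -
  have "m x y z = m y z x"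
    using assms by (simp add: median_perm)
  also have "\<dots> = m y z (m h x p)"
    using assms(1-5) by (subst x[symmetric]) (simp add: median_perm)
  also have "\<dots> = m (m y z h) (m y z x) p"
    using assms by (intro distrib3)
  also have "\<dots> = m p (m h y z) (m x y z)"
    using assms(1-5) by (simp add: closed median_perm)
  finally show ?thesis by simp
qed

text \<open>Pasch's property: if \<open>k\<close> lies between \<open>p\<close> and \<open>h\<close>, and \<open>h'\<close> between \<open>p\<close> and \<open>k'\<close>, then the
  segments \<open>[h, h']\<close> and \<open>[k, k']\<close> cross, namely at \<open>m h h' k\<close>. The computation runs through
  \<open>m h k h'\<close>, substituting the hypothesis on \<open>h'\<close> and cancelling \<open>p\<close> by the hypothesis on \<open>k\<close>.\<close>

lemma median_pasch:
  assumes M: "p \<in> M" "h \<in> M" "h' \<in> M" "k \<in> M" "k' \<in> M"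
    and k: "m p h k = k" and h': "m p k' h' = h'"
  shows "m k k' (m h h' k) = m h h' k"
proof -
  have "m h k h' = m h k (m p k' h')" using h' by simp
  also have "\<dots> = m (m h k p) (m h k k') h'" using M by (intro distrib3)
  also have "m h k p = k" using k M by (simp add: median_perm)
  also have "m k (m h k k') h' = m k h' (m k k' h)"
    using M by (simp add: closed median_perm)
  also have "\<dots> = m (m k h' k) (m k h' k') h" using M by (intro distrib3)
  also have "\<dots> = m (m k k' h') (m k k' k) h" using M by (simp add: absorb2 closed median_perm)
  also have "\<dots> = m k k' (m h' k h)" using M by (intro distrib3[symmetric])
  finally have "m h k h' = m k k' (m h' k h)" .
  then show ?thesis using M by (simp add: median_perm)
qed

lemma median_convexD: "\<lbrakk>median_convex M m C; x \<in> C; y \<in> C; z \<in> M\<rbrakk> \<Longrightarrow> m x y z \<in> C"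
  by (simp add: median_convex_def)

lemma median_convexD13: "\<lbrakk>median_convex M m C; x \<in> C; z \<in> C; y \<in> M\<rbrakk> \<Longrightarrow> m x y z \<in> C"
  using median_convexD[of C x z y] swap[of x y z] by (auto simp: median_convex_def subset_iff)

lemma median_convexD23: "\<lbrakk>median_convex M m C; y \<in> C; z \<in> C; x \<in> M\<rbrakk> \<Longrightarrow> m x y z \<in> C"
  using median_convexD[of C y z x] rotate[of x y z] by (auto simp: median_convex_def subset_iff)

lemma convex_subset: "median_convex M m C \<Longrightarrow> C \<subseteq> M"
  by (simp add: median_convex_def)

lemma convex_Int:
  "\<lbrakk>median_convex M m C; median_convex M m D\<rbrakk> \<Longrightarrow> median_convex M m (C \<inter> D)"
  by (auto simp: median_convex_def)

lemma convex_Inter: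
  "\<lbrakk>\<C> \<noteq> {}; \<And>C. C \<in> \<C> \<Longrightarrow> median_convex M m C\<rbrakk> \<Longrightarrow> median_convex M m (\<Inter>\<C>)"
  unfolding median_convex_def by blast

lemma convex_chain_Union:
  assumes "\<And>C. C \<in> \<C> \<Longrightarrow> median_convex M m C" "\<And>C D. \<lbrakk>C \<in> \<C>; D \<in> \<C>\<rbrakk> \<Longrightarrow> C \<subseteq> D \<or> D \<subseteq> C"
  shows "median_convex M m (\<Union>\<C>)"
  unfolding median_convex_def
proof (intro conjI ballI)
  show "\<Union>\<C> \<subseteq> M" using assms(1) convex_subset by blast
  fix x y z assume "x \<in> \<Union>\<C>" "y \<in> \<Union>\<C>" "z \<in> M"
  then obtain C where "C \<in> \<C>" "x \<in> C" "y \<in> C" using assms(2) by blast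
  then show "m x y z \<in> \<Union>\<C>" using assms(1) median_convexD \<open>z \<in> M\<close> by blast
qed

text \<open>The set is the union of all segments from \<open>p\<close> to points of \<open>H\<close>, that is, the down-closure of
  \<open>H\<close> in the order based at \<open>p\<close>. If \<open>x \<le> h\<close> and \<open>y \<le> h'\<close>, then \<open>m x y z \<le> m h h' z \<in> H\<close> by monotonicity
  in each argument.\<close>

lemma convex_join:
  assumes H: "median_convex M m H" and p: "p \<in> M"
  shows "median_convex M m {x \<in> M. \<exists>h\<in>H. m p h x = x}"
  unfolding median_convex_def
proof (intro conjI ballI)
  fix x y z 
  assume "x \<in> {x \<in> M. \<exists>h\<in>H. m p h x = x}" "y \<in> {x \<in> M. \<exists>h\<in>H. m p h x = x}" and z: "z \<in> M"
  then obtain h h' where x: "x \<in> M" "h \<in> H" "m p h x = x" and y: "y \<in> M" "h' \<in> H" "m p h' y = y"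
    by blast
  have h: "h \<in> M" "h' \<in> M" using x y H convex_subset by auto
  have "m p (m h y z) (m x y z) = m x y z"
    using between_mono p h x y z by simp
  moreover have "m p (m h h' z) (m h y z) = m h y z"
    using between_mono[of p h' y h z] p h y(1,3) z swap12[of h' h z] swap12[of y h z] by simp
  ultimately have "m p (m h h' z) (m x y z) = m x y z"
    using between_trans[of p "m x y z" "m h y z" "m h h' z"] p h x(1) y(1) z closed by simp
  then show "m x y z \<in> {x \<in> M. \<exists>h\<in>H. m p h x = x}"
    using x y z closed median_convexD[OF H x(2) y(2) z] by blast
qed auto

section \<open>The theorems of Helly and Kakutani\<close>

text \<open>Three pairwise intersecting convex sets have a common point: the median of a point from
  each pairwise intersection. So, intersecting all other members with a fixed member \<open>A\<close>
  preserves pairwise intersection and lowers the cardinality.\<close>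

lemma helly:
  assumes "finite \<C>" "\<C> \<noteq> {}"
    and "\<And>C. C \<in> \<C> \<Longrightarrow> median_convex M m C"
    and "\<And>C D. \<lbrakk>C \<in> \<C>; D \<in> \<C>\<rbrakk> \<Longrightarrow> C \<inter> D \<noteq> {}"
  shows "\<Inter>\<C> \<noteq> {}"
  using assms
proof (induction "card \<C>" arbitrary: \<C> rule: less_induct)
  case less
  obtain A where A: "A \<in> \<C>" using less.prems by blast
  show ?case
  proof (cases "\<C> = {A}")
    case True
    then show ?thesis using less.prems(4)[of A A] by simp
  next
    case False
    let ?D = "(\<lambda>C. A \<inter> C) ` (\<C> - {A})"
    \<comment> \<open>The map to \<open>?D\<close> need not be injective, so the cardinality is only bounded.\<close>
    have "card ?D \<le> card (\<C> - {A})" using less.prems(1) card_image_le by blast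
    also have "\<dots> < card \<C>" using A less.prems(1) by (intro card_Diff1_less)
    finally have card: "card ?D < card \<C>" .
    have ne: "?D \<noteq> {}" using False A by auto
    have meet: "C' \<inter> D' \<noteq> {}" if CD: "C' \<in> ?D" "D' \<in> ?D" for C' D'
    proof -
      obtain C D where C: "C \<in> \<C>" "C' = A \<inter> C" and D: "D \<in> \<C>" "D' = A \<inter> D" using CD by auto
      obtain a b c where a: "a \<in> C \<inter> D" and b: "b \<in> A \<inter> D" and c: "c \<in> A \<inter> C"
        using less.prems(4) A C D by (metis ex_in_conv)
      have cv: "median_convex M m A" "median_convex M m C" "median_convex M m D"
        using less.prems(3) A C D by auto
      have in_M: "a \<in> M" "b \<in> M" "c \<in> M" using a b c cv convex_subset by blast+
      have "m a b c \<in> A" "m a b c \<in> D" "m a b c \<in> C"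
        using median_convexD23[OF cv(1), of b c a] median_convexD[OF cv(3), of a b c] median_convexD13[OF cv(2), of a c b]
          a b c in_M by auto
      then show ?thesis using C D by blast
    qed
    have "\<Inter>?D \<noteq> {}"
    proof (rule less.hyps)
      show "median_convex M m C" if "C \<in> ?D" for C
        using that A less.prems(3) convex_Int by auto
    qed (use less.prems(1) card ne meet in blast)+
    moreover have "\<Inter>?D \<subseteq> \<Inter>\<C>"
      using ne by auto
    ultimately show ?thesis by blast
  qed
qed

lemma maximal_convex_disjoint:
  assumes "median_convex M m A" "A \<inter> B = {}"
  obtains H where "median_convex M m H" "A \<subseteq> H" "H \<inter> B = {}"
    "\<And>C. \<lbrakk>median_convex M m C; H \<subseteq> C; C \<inter> B = {}\<rbrakk> \<Longrightarrow> C = H"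
proof -
  let ?\<A> = "{C. median_convex M m C \<and> A \<subseteq> C \<and> C \<inter> B = {}}"
  have "\<exists>H\<in>?\<A>. \<forall>C\<in>?\<A>. H \<subseteq> C \<longrightarrow> C = H"
  proof (rule subset_Zorn_nonempty)
    show "?\<A> \<noteq> {}" using assms by blast
    fix \<C> assume ne: "\<C> \<noteq> {}" and "subset.chain ?\<A> \<C>"
    then have C: "\<C> \<subseteq> ?\<A>" "\<And>C D. \<lbrakk>C \<in> \<C>; D \<in> \<C>\<rbrakk> \<Longrightarrow> C \<subseteq> D \<or> D \<subseteq> C"
      by (auto simp: subset_chain_def)
    have "median_convex M m (\<Union>\<C>)" using C by (intro convex_chain_Union) auto
    then show "\<Union>\<C> \<in> ?\<A>" using C(1) ne by blast
  qed
  then show thesis using that by fastforce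
qed

text \<open>The join of \<open>H\<close> and \<open>p\<close> is a strictly larger convex set, so maximality makes it meet \<open>B\<close>. The
  point \<open>h0\<close> is needed to ensure that the join contains \<open>p\<close>.\<close>

lemma maximal_convex_meets_join:
  assumes H: "median_convex M m H" "h0 \<in> H" "H \<inter> B = {}"
    and max: "\<And>C. \<lbrakk>median_convex M m C; H \<subseteq> C; C \<inter> B = {}\<rbrakk> \<Longrightarrow> C = H"
    and p: "p \<in> M" "p \<notin> H"
  obtains h b where "h \<in> H" "b \<in> B" "b \<in> M" "m p h b = b"
proof -
  let ?J = "{x \<in> M. \<exists>h\<in>H. m p h x = x}"
  have "H \<subseteq> ?J" using convex_subset[OF H(1)] p absorb2(2) by blast
  moreover have "p \<in> ?J" using H p absorb2(1) convex_subset by blast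
  ultimately have "?J \<inter> B \<noteq> {}" using max[OF convex_join[OF H(1) p(1)]] p by blast
  then show thesis using that by blast
qed

text \<open>Kakutani's theorem. Enlarge \<open>A\<close> to a maximal convex set \<open>H\<close> missing \<open>B\<close>, and then \<open>B\<close> to a
  maximal convex set \<open>K\<close> missing \<open>H\<close>. Any point \<open>p\<close> outside both would put a point of \<open>K\<close> on
  a segment from \<open>p\<close> to \<open>H\<close> and a point of \<open>H\<close> on a segment from \<open>p\<close> to \<open>K\<close>; by Pasch, \<open>H\<close> and \<open>K\<close>
  would then intersect.\<close>

lemma convex_separation:
  assumes A: "median_convex M m A" "A \<noteq> {}" and B: "median_convex M m B" "B \<noteq> {}"
    and disj: "A \<inter> B = {}"
  obtains H where "H \<in> half_spaces M m" "A \<subseteq> H" "H \<inter> B = {}"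
proof -
  obtain H where H: "median_convex M m H" "A \<subseteq> H" "H \<inter> B = {}"
    "\<And>C. \<lbrakk>median_convex M m C; H \<subseteq> C; C \<inter> B = {}\<rbrakk> \<Longrightarrow> C = H"
    using maximal_convex_disjoint[OF A(1) disj] by metis
  obtain K where K: "median_convex M m K" "B \<subseteq> K" "K \<inter> H = {}"
    "\<And>C. \<lbrakk>median_convex M m C; K \<subseteq> C; C \<inter> H = {}\<rbrakk> \<Longrightarrow> C = K"
    using maximal_convex_disjoint[OF B(1), of H] H(3) by (metis Int_commute)
  have H_max: "C = H" if "median_convex M m C" "H \<subseteq> C" "C \<inter> K = {}" for C
    using H(4) K(2) that by blast
  have "M - H = K"
  proof (rule ccontr)
    assume "M - H \<noteq> K"
    then obtain p where p: "p \<in> M" "p \<notin> H" "p \<notin> K" using K convex_subset by blast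
    obtain h0 k0 where 0: "h0 \<in> H" "k0 \<in> K" using A B H K by blast
    obtain h k where hk: "h \<in> H" "k \<in> K" "m p h k = k"
      using maximal_convex_meets_join[OF H(1) 0(1) _ H_max p(1,2)] K(3) by blast
    obtain k' h' where kh: "k' \<in> K" "h' \<in> H" "m p k' h' = h'"
      using maximal_convex_meets_join[OF K(1) 0(2) K(3) K(4) p(1,3)] by blast
    have in_M: "h \<in> M" "k \<in> M" "h' \<in> M" "k' \<in> M" 
      using hk(1,2) kh(1,2) convex_subset[OF H(1)] convex_subset[OF K(1)] by auto
    have "m h h' k \<in> H" using median_convexD H(1) hk kh in_M by simp
    moreover have "m k k' (m h h' k) \<in> K" using median_convexD K(1) hk kh in_M closed by simp
    ultimately show False using median_pasch[of p h h' k k'] p hk kh in_M K(3) by auto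
  qed
  then show thesis using that[of H] H K convex_subset by (auto simp: half_spaces_def)
qed

section \<open>Half spaces are clopen\<close>

lemma half_space_compl: "H \<in> half_spaces M m \<Longrightarrow> M - H \<in> half_spaces M m"
  by (auto simp: half_spaces_def double_diff)

lemma half_space_convex:
  assumes "H \<in> half_spaces M m"
  shows "median_convex M m H" "median_convex M m (M - H)" "H \<subseteq> M"
  using assms by (auto simp: half_spaces_def)

lemma half_space_chain_Union:
  assumes "\<C> \<noteq> {}" "\<C> \<subseteq> half_spaces M m" "\<And>C D. \<lbrakk>C \<in> \<C>; D \<in> \<C>\<rbrakk> \<Longrightarrow> C \<subseteq> D \<or> D \<subseteq> C"
  shows "\<Union>\<C> \<in> half_spaces M m"
proof -
  have "median_convex M m (\<Union>\<C>)"
    using assms half_space_convex by (intro convex_chain_Union) auto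
  moreover have "median_convex M m (\<Inter>((\<lambda>C. M - C) ` \<C>))"
    using assms half_space_convex by (intro convex_Inter) auto
  moreover have "M - \<Union>\<C> = \<Inter>((\<lambda>C. M - C) ` \<C>)" using assms(1) by blast
  ultimately show ?thesis using convex_subset by (simp add: half_spaces_def)
qed

lemma half_space_openin: "H \<in> half_spaces M m \<Longrightarrow> openin (convex_topology M m) H"
  by (simp add: convex_topology_def topology_generated_by_Basis)

lemma half_space_closedin: "H \<in> half_spaces M m \<Longrightarrow> closedin (convex_topology M m) H"
  using half_space_convex half_space_compl half_space_openin
  by (simp add: closedin_def topspace_convex_topology)

lemma half_space_compactin:
  "\<lbrakk>compact_space (convex_topology M m); H \<in> half_spaces M m\<rbrakk>
    \<Longrightarrow> compactin (convex_topology M m) H"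
  by (simp add: closedin_compact_space half_space_closedin)

section \<open>Compactness bounds chains and transverse sets\<close>

text \<open>The union is a half space, hence compact, and is covered by the chain; finitely many members,
  hence the largest of these, already cover it.\<close>

lemma compact_chain_has_max:
  assumes cpt: "compact_space (convex_topology M m)"
    and C: "\<C> \<noteq> {}" "\<C> \<subseteq> half_spaces M m" "\<And>C D. \<lbrakk>C \<in> \<C>; D \<in> \<C>\<rbrakk> \<Longrightarrow> C \<subseteq> D \<or> D \<subseteq> C"
  shows "\<Union>\<C> \<in> \<C>"
proof -
  have "compactin (convex_topology M m) (\<Union>\<C>)"
    using half_space_compactin cpt half_space_chain_Union C by simp
  then obtain \<F> where F: "finite \<F>" "\<F> \<subseteq> \<C>" "\<Union>\<C> \<subseteq> \<Union>\<F>"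
    using compactinD[of _ "\<Union>\<C>" \<C>] C(2) half_space_openin by (metis order_refl subsetD)
  show ?thesis
  proof (cases "\<F> = {}")
    case True
    obtain C where "C \<in> \<C>" using C(1) by blast
    moreover have "\<Union>\<C> = {}" using F(3) True by simp
    then have "C = \<Union>\<C>" using \<open>C \<in> \<C>\<close> by blast
    ultimately show ?thesis by simp
  next
    case False
    have "subset.chain \<C> \<F>" using F(2) C(3) by (auto simp: subset_chain_def)
    then have "\<Union>\<F> \<in> \<F>" using Union_in_chain F False by blast
    moreover have "\<Union>\<F> = \<Union>\<C>" using F by blast
    ultimately show ?thesis using F by auto
  qed
qed

lemma compact_chain_has_min:
  assumes cpt: "compact_space (convex_topology M m)"
    and C: "\<C> \<noteq> {}" "\<C> \<subseteq> half_spaces M m" "\<And>C D. \<lbrakk>C \<in> \<C>; D \<in> \<C>\<rbrakk> \<Longrightarrow> C \<subseteq> D \<or> D \<subseteq> C"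
  shows "\<Inter>\<C> \<in> \<C>"
proof -
  have "\<Union>((\<lambda>C. M - C) ` \<C>) \<in> (\<lambda>C. M - C) ` \<C>"
  proof (rule compact_chain_has_max[OF cpt])
    show "(\<lambda>C. M - C) ` \<C> \<subseteq> half_spaces M m" using C(2) half_space_compl by blast
    show "C \<subseteq> D \<or> D \<subseteq> C" if "C \<in> (\<lambda>C. M - C) ` \<C>" "D \<in> (\<lambda>C. M - C) ` \<C>" for C D
      using that C(3) by blast
  qed (use C(1) in simp)
  then obtain D where D: "D \<in> \<C>" "\<Union>((\<lambda>C. M - C) ` \<C>) = M - D" by blast
  have "D \<subseteq> C" if "C \<in> \<C>" for C using that D half_space_convex(3) C(2) by blast
  then have "\<Inter>\<C> = D" using D(1) by blast
  then show ?thesis using D by simp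
qed

lemma compact_finite_chain:
  assumes cpt: "compact_space (convex_topology M m)"
    and C: "\<C> \<subseteq> half_spaces M m" "Complete_Partial_Order.chain (\<subseteq>) \<C>"
  shows "finite \<C>"
proof (rule finite_if_max_min)
  have chain: "C \<subseteq> D \<or> D \<subseteq> C" if "C \<in> \<C>" "D \<in> \<C>" for C D
    using that C(2) by (simp add: Complete_Partial_Order.chain_def)
  fix \<D> assume D: "\<D> \<subseteq> \<C>" "\<D> \<noteq> {}"
  show "\<Union>\<D> \<in> \<D>"
    using D C(1) chain by (intro compact_chain_has_max[OF cpt]) blast+
  show "\<Inter>\<D> \<in> \<D>"
    using D C(1) chain by (intro compact_chain_has_min[OF cpt]) blast+
qed

lemma transverse_orthants_nonempty:
  assumes "s \<in> half_spaces M m" "t \<in> half_spaces M m" 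
   and "poc_transverse (\<subseteq>) (\<lambda>H. M - H) s t"
  shows "s \<inter> t \<noteq> {}" "s \<inter> (M - t) \<noteq> {}" "(M - s) \<inter> t \<noteq> {}" "(M - s) \<inter> (M - t) \<noteq> {}"
proof -
  have "s \<subseteq> M" "t \<subseteq> M" using assms half_space_convex(3) by auto
  moreover have "\<not> s \<subseteq> t" "\<not> t \<subseteq> s" "\<not> s \<subseteq> M - t" "\<not> M - t \<subseteq> s"
    using assms(3) by (auto simp: poc_transverse_def poc_nested_def)
  ultimately show "s \<inter> t \<noteq> {}" "s \<inter> (M - t) \<noteq> {}" "(M - s) \<inter> t \<noteq> {}" "(M - s) \<inter> (M - t) \<noteq> {}"
    by blast+
qed

text \<open>Helly's theorem handles finitely many sides and compactness all of them. It requires each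
  side to be nonempty; the infinitude of \<open>T\<close> is used to find, for a given
  member, another one transverse to it.\<close>

lemma compact_orthant_nonempty:
  assumes cpt: "compact_space (convex_topology M m)"
    and T: "T \<subseteq> half_spaces M m" "pairwise (poc_transverse (\<subseteq>) (\<lambda>H. M - H)) T" "infinite T"
  obtains x where "x \<in> M" "\<And>t. t \<in> T \<Longrightarrow> x \<in> t \<longleftrightarrow> t \<in> S"
proof -
  define side where "side t = (if t \<in> S then t else M - t)" for t
  have half: "side t \<in> half_spaces M m" if "t \<in> T" for t
    using that T(1) half_space_compl by (auto simp: side_def)
  have meet: "side s \<inter> side t \<noteq> {}" if st: "s \<in> T" "t \<in> T" for s t
  proof (cases "s = t")
    case False
    then have "poc_transverse (\<subseteq>) (\<lambda>H. M - H) s t" using T(2) st by (simp add: pairwise_def)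
    then show ?thesis
      using transverse_orthants_nonempty[of s t] st T(1) by (auto simp: side_def)
  next
    case True
    obtain u where u: "u \<in> T" "u \<noteq> t" 
      using T(3) by (metis finite.emptyI finite_insert insert_iff subsetI finite_subset)
    then have "poc_transverse (\<subseteq>) (\<lambda>H. M - H) t u" using T(2) st by (auto simp: pairwise_def)
    then show ?thesis
      using transverse_orthants_nonempty[of t u] st T(1) u True by (auto simp: side_def)
  qed
  have "\<Inter>(side ` T) \<noteq> {}"
  proof (rule cpt[unfolded compact_space_fip, rule_format], intro conjI ballI allI impI)
    show "closedin (convex_topology M m) C" if "C \<in> side ` T" for C
      using that half half_space_closedin by blast
    fix \<F> assume F: "finite \<F> \<and> \<F> \<subseteq> side ` T"
    show "\<Inter>\<F> \<noteq> {}"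
    proof (cases "\<F> = {}")
      case False
      show ?thesis
      proof (rule helly)
        show "median_convex M m C" if "C \<in> \<F>" for C
          using that F half half_space_convex(1) by blast
        show "C \<inter> D \<noteq> {}" if "C \<in> \<F>" "D \<in> \<F>" for C D
          using that F meet by blast
      qed (use F False in auto)
    qed simp
  qed
  then obtain x where x: "\<And>t. t \<in> T \<Longrightarrow> x \<in> side t" by blast
  obtain t where t: "t \<in> T" using T(3) by (metis finite.emptyI ex_in_conv)
  have "x \<in> M" using x[OF t] half[OF t] half_space_convex(3) by blast
  moreover have "x \<in> t \<longleftrightarrow> t \<in> S" if "t \<in> T" for t
    using x[OF that] by (auto simp: side_def split: if_splits)
  ultimately show thesis using that by blast
qed

text \<open>Membership in a half space that contains \<open>\<Inter>T\<close> and misses every point lying in only finitely many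
  members of \<open>T\<close> cannot be forced by finitely many members of \<open>T\<close>; but compactness of the
  complement would make \<open>\<Inter>F\<close>, for a finite \<open>F \<subseteq> T\<close>, a subset of it. Those finitely covered points form
  a convex set \<open>B\<close>, since a half space containing \<open>m x y z\<close> contains \<open>x\<close> or \<open>y\<close> by convexity
  of its complement, so Kakutani's theorem produces such a half space when \<open>T\<close> is infinite.\<close>

lemma compact_finite_transverse:
  assumes cpt: "compact_space (convex_topology M m)"
    and T: "T \<subseteq> half_spaces M m" "pairwise (poc_transverse (\<subseteq>) (\<lambda>H. M - H)) T"
  shows "finite T"
proof (rule ccontr)
  assume inf: "infinite T"
  note orthant = compact_orthant_nonempty[OF cpt T inf]
  define B where "B = {x \<in> M. finite {t \<in> T. x \<in> t}}"
  have A: "median_convex M m (\<Inter>T)"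
    using inf T(1) half_space_convex(1) by (intro convex_Inter) auto
  have B: "median_convex M m B"
    unfolding median_convex_def
  proof (intro conjI ballI)
    fix x y z assume xyz: "x \<in> B" "y \<in> B" "z \<in> M"
    then have in_M: "x \<in> M" "y \<in> M" by (auto simp: B_def)
    have "{t \<in> T. m x y z \<in> t} \<subseteq> {t \<in> T. x \<in> t} \<union> {t \<in> T. y \<in> t}"
    proof -
      have "m x y z \<in> M - t" if "t \<in> T" "x \<notin> t" "y \<notin> t" for t
        using that in_M xyz T(1) half_space_convex(2)[of t] by (intro median_convexD[of "M - t"]) auto
      then show ?thesis by blast
    qed
    moreover have "finite ({t \<in> T. x \<in> t} \<union> {t \<in> T. y \<in> t})" using xyz by (simp add: B_def)
    ultimately have "finite {t \<in> T. m x y z \<in> t}" by (rule finite_subset)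
    then show "m x y z \<in> B" using in_M xyz closed by (simp add: B_def)
  qed (auto simp: B_def)
  have point: "\<exists>x\<in>B. x \<in> \<Inter>F" if "finite F" "F \<subseteq> T" for F
  proof -
    obtain x where x: "x \<in> M" "\<And>t. t \<in> T \<Longrightarrow> x \<in> t \<longleftrightarrow> t \<in> F" using orthant[of F] by blast
    have "{t \<in> T. x \<in> t} \<subseteq> F" using x by blast
    then have "x \<in> B" using x that finite_subset by (auto simp: B_def)
    then show ?thesis using x that by blast
  qed
  obtain x where "\<And>t. t \<in> T \<Longrightarrow> x \<in> t"
    using orthant[of T] by metis
  then have "\<Inter>T \<noteq> {}" by blast
  moreover have "B \<noteq> {}" using point[of "{}"] by blast
  moreover have "\<Inter>T \<inter> B = {}"
  proof -
    have "{t \<in> T. x \<in> t} = T" if "x \<in> \<Inter>T" for x using that by blast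
    then show ?thesis using inf by (auto simp: B_def)
  qed
  ultimately obtain H where H: "H \<in> half_spaces M m" "\<Inter>T \<subseteq> H" "H \<inter> B = {}"
    using convex_separation A B by metis
  have "compactin (convex_topology M m) (M - H)"
    using half_space_compactin[OF cpt] half_space_compl H(1) by blast
  moreover have "\<And>U. U \<in> (\<lambda>t. M - t) ` T \<Longrightarrow> openin (convex_topology M m) U"
    using T(1) half_space_compl half_space_openin by blast
  moreover have "M - H \<subseteq> \<Union>((\<lambda>t. M - t) ` T)" using H(2) by blast
  ultimately obtain \<F> where "finite \<F>" "\<F> \<subseteq> (\<lambda>t. M - t) ` T" "M - H \<subseteq> \<Union>\<F>"
    using compactinD[of _ "M - H" "(\<lambda>t. M - t) ` T"] by metis
  then obtain F where F: "finite F" "F \<subseteq> T" "M - H \<subseteq> \<Union>((\<lambda>t. M - t) ` F)"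
    by (metis finite_subset_image)
  obtain x where "x \<in> B" "x \<in> \<Inter>F" using point F by blast
  then show False using F(3) H(3) by (auto simp: B_def)
qed

section \<open>Covers by half spaces under type omega\<close>

text \<open>Alexander's subbase theorem for the convex topology. What has to be proved is that the
  topology generated by the half spaces has as its open sets the unions of finite
  intersections relative to \<open>M\<close>.\<close>

lemma convex_topology_compact_if_subbasic:
  assumes "\<And>\<U>. \<lbrakk>\<U> \<subseteq> half_spaces M m; \<Union>\<U> = M\<rbrakk> \<Longrightarrow> \<exists>\<F>. finite \<F> \<and> \<F> \<subseteq> \<U> \<and> \<Union>\<F> = M"
  shows "compact_space (convex_topology M m)"
proof (rule Alexander_subbase)
  let ?B = "half_spaces M m"
  let ?X = "topology (arbitrary union_of (finite intersection_of (\<lambda>x. x \<in> ?B) relative_to \<Union>?B))"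
  have "openin ?X S" if "S \<in> ?B" for S
    using that unfolding openin_subbase
    by (intro arbitrary_union_of_inc relative_to_subset_inc finite_intersection_of_inc) auto
  then have "openin ?X S" if "openin (convex_topology M m) S" for S
    using that generate_topology_on_coarsest[of "openin ?X" ?B S]
    by (simp add: convex_topology_def openin_topology_generated_by_iff)
  moreover have "openin (convex_topology M m) S" if op: "openin ?X S" for S
  proof -
    have UB: "\<Union>?B = topspace (convex_topology M m)" by (simp add: convex_topology_def)
    obtain \<K> where "\<K> \<subseteq> Collect (finite intersection_of (\<lambda>x. x \<in> ?B) relative_to \<Union>?B)"
      and S: "\<Union>\<K> = S"
      using op[unfolded openin_subbase] by (auto simp: union_of_def)
    then have K: "(finite intersection_of (\<lambda>x. x \<in> ?B) relative_to \<Union>?B) K" if "K \<in> \<K>" for K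
      using that by blast
    have "openin (convex_topology M m) K" if "K \<in> \<K>" for K
    proof -
      obtain \<F> where F: "finite \<F>" "\<F> \<subseteq> ?B" "K = \<Union>?B \<inter> \<Inter>\<F>"
        using K[OF \<open>K \<in> \<K>\<close>] by (auto simp: relative_to_def intersection_of_def)
      then show ?thesis 
        unfolding UB F using half_space_openin
        by (cases "\<F> = {}") (auto intro!: openin_Int openin_Inter)
    qed
    then show ?thesis unfolding S[symmetric] by blast
  qed
  ultimately show "?X = convex_topology M m" by (metis topology_eq)
qed (use assms topspace_convex_topology in auto)

text \<open>The points \<open>x\<close>, \<open>y\<close>, \<open>z\<close> are chosen so that no maximal member of the cover contains two of
  them; the family \<open>\<G>\<close> consists of these maximal members.\<close>

lemma half_space_cover_has_finite_subcover:
  assumes omega: "poc_type_omega (half_spaces M m) (\<subseteq>) (\<lambda>H. M - H)"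
    and U: "\<U> \<subseteq> half_spaces M m" "\<Union>\<U> = M"
  shows "\<exists>\<F>. finite \<F> \<and> \<F> \<subseteq> \<U> \<and> \<Union>\<F> = M"
proof (rule ccontr)
  assume none: "\<nexists>\<F>. finite \<F> \<and> \<F> \<subseteq> \<U> \<and> \<Union>\<F> = M"
  have escape: "\<exists>x\<in>M. x \<notin> \<Union>\<F>" if "finite \<F>" "\<F> \<subseteq> \<U>" for \<F>
  proof -
    have "\<Union>\<F> \<noteq> M" "\<Union>\<F> \<subseteq> M" using none that U(2) by auto
    then show ?thesis by blast
  qed
  define \<G> where "\<G> = {G \<in> \<U>. \<forall>X\<in>\<U>. G \<subseteq> X \<longrightarrow> X = G}"
  have maximal: "\<exists>G\<in>\<G>. V \<subseteq> G" if V: "V \<in> \<U>" for V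
  proof -
    have "\<exists>G\<in>{X \<in> \<U>. V \<subseteq> X}. \<forall>X\<in>{X \<in> \<U>. V \<subseteq> X}. G \<subseteq> X \<longrightarrow> X = G"
    proof (rule subset_Zorn_nonempty)
      fix \<C> assume C: "\<C> \<noteq> {}" "subset.chain {X \<in> \<U>. V \<subseteq> X} \<C>"
      then have "Complete_Partial_Order.chain (\<subseteq>) \<C>" "\<C> \<subseteq> half_spaces M m"
        using U by (auto simp: subset_chain_def Complete_Partial_Order.chain_def)
      then have "finite \<C>" using omega by (simp add: poc_type_omega_def)
      then have "\<Union>\<C> \<in> \<C>" using Union_in_chain C by blast
      then show "\<Union>\<C> \<in> {X \<in> \<U>. V \<subseteq> X}" using C(2) by (auto simp: subset_chain_def)
    qed (use V in blast)
    then obtain G where "G \<in> \<U>" "V \<subseteq> G" "\<And>X. \<lbrakk>X \<in> \<U>; V \<subseteq> X; G \<subseteq> X\<rbrakk> \<Longrightarrow> X = G" by auto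
    then show ?thesis unfolding \<G>_def by blast
  qed
  have fin: "finite {G \<in> \<G>. x \<in> G}" if "x \<in> M" for x
  proof -
    have "poc_transverse (\<subseteq>) (\<lambda>H. M - H) G G'"
      if G: "G \<in> \<G>" "x \<in> G" "G' \<in> \<G>" "x \<in> G'" "G \<noteq> G'" for G G'
    proof -
      have "\<not> G \<subseteq> G'" "\<not> G' \<subseteq> G" using G by (auto simp: \<G>_def)
      moreover have "\<not> G \<subseteq> M - G'" using G by blast
      moreover have "\<not> M - G' \<subseteq> G" using escape[of "{G, G'}"] G by (auto simp: \<G>_def)
      ultimately show ?thesis by (simp add: poc_transverse_def poc_nested_def)
    qed
    then have "pairwise (poc_transverse (\<subseteq>) (\<lambda>H. M - H)) {G \<in> \<G>. x \<in> G}"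
      by (simp add: pairwise_def)
    moreover have "{G \<in> \<G>. x \<in> G} \<subseteq> half_spaces M m" using U by (auto simp: \<G>_def)
    ultimately show ?thesis using omega by (simp add: poc_type_omega_def)
  qed
  have GU: "\<G> \<subseteq> \<U>" by (auto simp: \<G>_def)
  obtain x where x: "x \<in> M" using nonempty by blast
  have "\<exists>y\<in>M. y \<notin> \<Union>{G \<in> \<G>. x \<in> G}"
    using GU by (intro escape fin x) auto
  then obtain y where y: "y \<in> M" "\<And>G. \<lbrakk>G \<in> \<G>; x \<in> G\<rbrakk> \<Longrightarrow> y \<notin> G" by auto
  have "\<exists>z\<in>M. z \<notin> \<Union>({G \<in> \<G>. x \<in> G} \<union> {G \<in> \<G>. y \<in> G})"
    using GU by (intro escape finite_UnI fin x y(1)) auto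
  then obtain z where z: "z \<in> M" "\<And>G. \<lbrakk>G \<in> \<G>; x \<in> G\<rbrakk> \<Longrightarrow> z \<notin> G"
    "\<And>G. \<lbrakk>G \<in> \<G>; y \<in> G\<rbrakk> \<Longrightarrow> z \<notin> G" by auto
  have "m x y z \<in> \<Union>\<U>" using closed[OF x y(1) z(1)] U(2) by simp
  then obtain V where "V \<in> \<U>" "m x y z \<in> V" by blast
  then obtain G where G: "G \<in> \<G>" "m x y z \<in> G" using maximal by blast
  have cv: "median_convex M m (M - G)" using G GU U half_space_convex(2) by blast
  have "m x y z \<in> M - G"
  proof (cases "x \<in> G")
    case True
    then show ?thesis using y z G x by (intro median_convexD23[OF cv]) auto
  next
    case False
    then show ?thesis
      using median_convexD[OF cv, of x y z] median_convexD13[OF cv, of x z y] x y(1) z G by blast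
  qed
  then show False using G by blast
qed

end

theorem theorem5p12:
  fixes M :: "'a set" and m :: "'a \<Rightarrow> 'a \<Rightarrow> 'a \<Rightarrow> 'a"
  assumes "median_algebra M m"
  shows "compact_space (convex_topology M m) \<longleftrightarrow>
    poc_type_omega (half_spaces M m) (\<subseteq>) (\<lambda>H. M - H)"
proof
  interpret median_algebra M m by fact
  show "poc_type_omega (half_spaces M m) (\<subseteq>) (\<lambda>H. M - H)" if "compact_space (convex_topology M m)"
    unfolding poc_type_omega_def
    using compact_finite_chain[OF that] compact_finite_transverse[OF that] by blast
  show "compact_space (convex_topology M m)" if "poc_type_omega (half_spaces M m) (\<subseteq>) (\<lambda>H. M - H)"
    using convex_topology_compact_if_subbasic half_space_cover_has_finite_subcover[OF that] by simp
qed

end
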